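(* For any $\mathsf{snr}_0>0$ and any $\beta>0$ there exists a real random variable $X$ with full power $\mathbb{E}[X^2]=1$ such that $$\mathrm{mmse}(X,\mathsf{snr}_0)\le\frac{\beta}{1+\beta\,\mathsf{snr}_0}.$$
   Context: For a real random variable $X$ and $\mathsf{snr}\ge0$, let $Y=\sqrt{\mathsf{snr}}\,X+Z$ with $Z\sim\mathcal{N}(0,1)$ independent of $X$, and $\mathrm{mmse}(X,\mathsf{snr})=\mathbb{E}[(X-\mathbb{E}[X|Y])^2]$. The power constraint is $\mathbb{E}[X^2]\le1$. *)

theory Defs
  imports "HOL-Probability.Probability"
begin

text \<open>
  Conditional expectation \<open>E[X | Y]\<close> of a real random variable given a real random variable:
  conditioning on the sigma-algebra generated by \<open>Y\<close>.
\<close>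

definition cond_mean :: "'a measure \<Rightarrow> ('a \<Rightarrow> real) \<Rightarrow> ('a \<Rightarrow> real) \<Rightarrow> 'a \<Rightarrow> real" where
  "cond_mean M X Y = real_cond_exp M (vimage_algebra (space M) Y borel) X"

text \<open>
  The noise \<open>Z\<close>, standard normal and independent of \<open>X\<close>, is adjoined by passing to the product
  space: on \<open>M \<Otimes>\<^sub>M std_normal_distribution\<close> the input is \<open>X \<circ> fst\<close> and the noise is \<open>snd\<close>.
  The joint law of input and noise, hence the value below, depends only on the law of \<open>X\<close>.
  The Bochner integral equals 0 for non-integrable integrands, so the definition is meaningful
  for \<open>X\<close> with finite second moment, where the squared error is integrable.
\<close>

definition channel_space :: "'a measure \<Rightarrow> ('a \<times> real) measure" where
  "channel_space M = M \<Otimes>\<^sub>M std_normal_distribution"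

definition channel_output :: "('a \<Rightarrow> real) \<Rightarrow> real \<Rightarrow> 'a \<times> real \<Rightarrow> real" where
  "channel_output X snr = (\<lambda>(\<omega>, z). sqrt snr * X \<omega> + z)"

definition mmse :: "'a measure \<Rightarrow> ('a \<Rightarrow> real) \<Rightarrow> real \<Rightarrow> real" where
  "mmse M X snr =
    (\<integral>w. (X (fst w) - cond_mean (channel_space M) (X \<circ> fst) (channel_output X snr) w)\<^sup>2
       \<partial>channel_space M)"

end

theory Submission
  imports Defs
begin

text \<open>
  Take \<open>X\<close> equal to \<open>A\<close> with probability \<open>1 / A\<^sup>2\<close> and to \<open>0\<close> otherwise. Estimating \<open>X\<close> by
  thresholding the output at the midpoint \<open>sqrt snr * A / 2\<close> errs only if
  \<open>\<bar>Z\<bar> \<ge> sqrt snr * A / 2\<close>, so by the fourth-moment Markov bound the mean square error is at most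
  \<open>A\<^sup>2 * E[Z ^ 4] / (sqrt snr * A / 2) ^ 4 = 48 / (snr\<^sup>2 * A\<^sup>2)\<close>, which vanishes as \<open>A\<close> grows.
\<close>

lemma (in finite_measure_subalgebra) integral_square_diff_real_cond_exp_le:
  assumes D: "integrable M D" and D2: "integrable M (\<lambda>x. (D x)\<^sup>2)"
  shows "(\<integral>x. (D x - real_cond_exp M F D x)\<^sup>2 \<partial>M) \<le> (\<integral>x. (D x)\<^sup>2 \<partial>M)"
proof -
  let ?V = "real_cond_exp M F D"
  have [measurable]: "D \<in> borel_measurable M"
    using D by auto
  have V2: "integrable M (\<lambda>x. (?V x)\<^sup>2)"
    by (rule integrable_convex_cond_exp[where I = UNIV and q = "\<lambda>x. x\<^sup>2"])
       (use D D2 in \<open>auto simp: convex_power2\<close>)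
  have VD: "integrable M (\<lambda>x. ?V x * D x)"
  proof (rule Bochner_Integration.integrable_bound[OF Bochner_Integration.integrable_add[OF D2 V2]])
    show "AE x in M. norm (?V x * D x) \<le> norm ((D x)\<^sup>2 + (?V x)\<^sup>2)"
    proof (rule AE_I2)
      fix x
      have "2 * (\<bar>?V x\<bar> * \<bar>D x\<bar>) \<le> (D x)\<^sup>2 + (?V x)\<^sup>2"
        using zero_le_power2[of "\<bar>D x\<bar> - \<bar>?V x\<bar>"] by (simp add: power2_diff mult_ac)
      moreover have "0 \<le> \<bar>?V x\<bar> * \<bar>D x\<bar>"
        by simp
      ultimately show "norm (?V x * D x) \<le> norm ((D x)\<^sup>2 + (?V x)\<^sup>2)"
        unfolding real_norm_def abs_mult by linarith
    qed
  qed measurable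
  have "(\<integral>x. ?V x * ?V x \<partial>M) = (\<integral>x. ?V x * D x \<partial>M)"
    by (rule real_cond_exp_intg(2)[OF VD]) auto
  then have eq: "(\<integral>x. ?V x * D x \<partial>M) = (\<integral>x. (?V x)\<^sup>2 \<partial>M)"
    by (simp add: power2_eq_square)
  have "(\<integral>x. (D x - ?V x)\<^sup>2 \<partial>M) = (\<integral>x. (D x)\<^sup>2 + (?V x)\<^sup>2 - 2 * (?V x * D x) \<partial>M)"
    by (simp add: power2_diff mult_ac)
  also have "\<dots> = (\<integral>x. (D x)\<^sup>2 \<partial>M) - (\<integral>x. (?V x)\<^sup>2 \<partial>M)"
    using D2 V2 VD eq by simp
  also have "\<dots> \<le> (\<integral>x. (D x)\<^sup>2 \<partial>M)"
    by simp
  finally show ?thesis .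
qed

text \<open>
  The residual of \<open>X\<close> equals that of \<open>X - W\<close>, since \<open>W\<close> is its own conditional expectation.
\<close>

lemma (in finite_measure_subalgebra) real_cond_exp_minimizes_square_error:
  assumes X: "integrable M X" and W: "integrable M W" "W \<in> borel_measurable F"
    and sq: "integrable M (\<lambda>x. (X x - W x)\<^sup>2)"
  shows "(\<integral>x. (X x - real_cond_exp M F X x)\<^sup>2 \<partial>M) \<le> (\<integral>x. (X x - W x)\<^sup>2 \<partial>M)"
proof -
  let ?D = "\<lambda>x. X x - W x"
  have [measurable]: "X \<in> borel_measurable M" "W \<in> borel_measurable M"
    using X W by auto
  have "AE x in M. (X x - real_cond_exp M F X x)\<^sup>2 = (?D x - real_cond_exp M F ?D x)\<^sup>2"
    using real_cond_exp_diff[OF X W(1)] real_cond_exp_F_meas[OF W] by eventually_elim simp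
  then have "(\<integral>x. (X x - real_cond_exp M F X x)\<^sup>2 \<partial>M)
      = (\<integral>x. (?D x - real_cond_exp M F ?D x)\<^sup>2 \<partial>M)"
    by (intro integral_cong_AE) auto
  also have "\<dots> \<le> (\<integral>x. (?D x)\<^sup>2 \<partial>M)"
    by (rule integral_square_diff_real_cond_exp_le) (use X W sq in auto)
  finally show ?thesis .
qed

lemma prob_space_std_normal: "prob_space std_normal_distribution"
  by (simp add: prob_space_normal_density)

lemma prob_space_channel_space:
  assumes "prob_space M"
  shows "prob_space (channel_space M)"
  unfolding channel_space_def using assms prob_space_std_normal by (rule prob_space_pair)

lemma measurable_channel_output [measurable]:
  "X \<in> borel_measurable M \<Longrightarrow> channel_output X snr \<in> borel_measurable (channel_space M)"
  unfolding channel_output_def channel_space_def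
  by (auto simp: case_prod_beta intro!: borel_measurable_add borel_measurable_times
      measurable_compose[OF measurable_fst] measurable_compose[OF measurable_snd, where g = "\<lambda>z. z"])

lemma mmse_le_estimator_error:
  fixes g :: "real \<Rightarrow> real"
  assumes M: "prob_space M" and X[measurable]: "X \<in> borel_measurable M"
    and g: "g \<in> borel_measurable borel"
    and bX: "\<And>\<omega>. \<bar>X \<omega>\<bar> \<le> B" and bg: "\<And>y. \<bar>g y\<bar> \<le> B"
  shows "mmse M X snr \<le> (\<integral>w. (X (fst w) - g (channel_output X snr w))\<^sup>2 \<partial>channel_space M)"
proof -
  let ?C = "channel_space M" and ?Y = "channel_output X snr"
  let ?F = "vimage_algebra (space ?C) ?Y borel"
  interpret C: prob_space ?C
    using M by (rule prob_space_channel_space)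
  have Xf [measurable]: "(X \<circ> fst) \<in> borel_measurable ?C"
    unfolding channel_space_def by measurable
  have sub: "subalgebra ?C ?F"
    unfolding subalgebra_def by (simp add: sets_image_in_sets)
  interpret finite_measure_subalgebra ?C ?F
    by unfold_locales (rule sub)
  have gF: "(\<lambda>w. g (?Y w)) \<in> borel_measurable ?F"
    by (rule measurable_compose[OF _ g], rule measurable_vimage_algebra1) simp
  have gM [measurable]: "(\<lambda>w. g (?Y w)) \<in> borel_measurable ?C"
    using measurable_from_subalg[OF sub gF] .
  have iX: "integrable ?C (X \<circ> fst)"
    by (rule C.integrable_const_bound[where B = B]) (use bX in auto)
  have ig: "integrable ?C (\<lambda>w. g (?Y w))"
    by (rule C.integrable_const_bound[where B = B]) (use bg in auto)
  have isq: "integrable ?C (\<lambda>w. ((X \<circ> fst) w - g (?Y w))\<^sup>2)"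
  proof (rule C.integrable_const_bound[where B = "(2 * B)\<^sup>2"])
    show "AE w in ?C. norm (((X \<circ> fst) w - g (?Y w))\<^sup>2) \<le> (2 * B)\<^sup>2"
    proof (rule AE_I2)
      fix w
      have "\<bar>X (fst w) - g (?Y w)\<bar> \<le> 2 * B"
        using bX[of "fst w"] bg[of "?Y w"] by linarith
      then show "norm (((X \<circ> fst) w - g (?Y w))\<^sup>2) \<le> (2 * B)\<^sup>2"
        using power_mono[of "\<bar>X (fst w) - g (?Y w)\<bar>" "2 * B" 2] by simp
    qed
  qed measurable
  show ?thesis
    using real_cond_exp_minimizes_square_error[OF iX ig gF isq]
    unfolding mmse_def cond_mean_def comp_apply .
qed

lemma threshold_square_error_le:
  fixes s A x z :: real
  assumes s: "0 < s" and A: "0 < A" and x: "x = 0 \<or> x = A"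
  shows "(x - (if s * A / 2 < s * x + z then A else 0))\<^sup>2 \<le> 16 / (s ^ 4 * A\<^sup>2) * z ^ 4"
proof (cases "s * A / 2 \<le> \<bar>z\<bar>")
  case True
  have "(s * A / 2) ^ 4 \<le> \<bar>z\<bar> ^ 4"
    using True s A by (intro power_mono) auto
  then have "s ^ 4 * A ^ 4 \<le> 16 * z ^ 4"
    by (simp add: power_mult_distrib power_divide)
  then have "A\<^sup>2 \<le> 16 / (s ^ 4 * A\<^sup>2) * z ^ 4"
    using s A by (simp add: field_simps flip: power_add)
  moreover have "(x - (if s * A / 2 < s * x + z then A else 0))\<^sup>2 \<le> A\<^sup>2"
    using x by auto
  ultimately show ?thesis
    by linarith
next
  case False
  then have "x = (if s * A / 2 < s * x + z then A else 0)"
    using x s A by (auto simp: abs_if split: if_splits)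
  then show ?thesis
    by simp
qed

lemma fourth_moment_channel_noise:
  assumes "prob_space M"
  shows "integrable (channel_space M) (\<lambda>w. snd w ^ 4)"
    and "(\<integral>w. snd w ^ 4 \<partial>channel_space M) = 3"
proof -
  let ?N = "std_normal_distribution"
  interpret M: prob_space M by fact
  interpret N: prob_space ?N by (rule prob_space_std_normal)
  have distr: "distr (channel_space M) ?N snd = ?N"
    unfolding channel_space_def
  proof (rule measure_eqI)
    fix A assume "A \<in> sets (distr (M \<Otimes>\<^sub>M ?N) ?N snd)"
    then have A: "A \<in> sets ?N"
      by simp
    have "snd -` A \<inter> space (M \<Otimes>\<^sub>M ?N) = space M \<times> A"
      using sets.sets_into_space[OF A] by (auto simp: space_pair_measure)
    moreover have "emeasure (M \<Otimes>\<^sub>M ?N) (space M \<times> A) = emeasure ?N A"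
      using N.emeasure_pair_measure_Times[of "space M" M A] A by (simp add: M.emeasure_space_1)
    ultimately show "emeasure (distr (M \<Otimes>\<^sub>M ?N) ?N snd) A = emeasure ?N A"
      using A by (simp add: emeasure_distr measurable_snd)
  qed simp
  have snd: "snd \<in> channel_space M \<rightarrow>\<^sub>M ?N"
    unfolding channel_space_def by measurable
  have "integrable (distr (channel_space M) ?N snd) (\<lambda>x. x ^ 4)"
    unfolding distr by (rule integrable_std_normal_distribution_moment)
  then show "integrable (channel_space M) (\<lambda>w. snd w ^ 4)"
    using integrable_distr[OF snd] by blast
  have "(\<integral>w. snd w ^ 4 \<partial>channel_space M) = (\<integral>x. x ^ 4 \<partial>distr (channel_space M) ?N snd)"
    by (subst integral_distr[OF snd]) auto
  also have "\<dots> = 3"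
    unfolding distr using std_normal_distribution_even_moments(1)[of 2]
    by (simp add: fact_numeral)
  finally show "(\<integral>w. snd w ^ 4 \<partial>channel_space M) = 3" .
qed

lemma mmse_two_point_le:
  assumes M: "prob_space M" and X[measurable]: "X \<in> borel_measurable M"
    and s: "0 < snr" and A: "0 < A" and val: "\<And>\<omega>. X \<omega> = 0 \<or> X \<omega> = A"
  shows "mmse M X snr \<le> 48 / (snr\<^sup>2 * A\<^sup>2)"
proof -
  let ?g = "\<lambda>y. if sqrt snr * A / 2 < y then A else 0"
  let ?C = "channel_space M"
  let ?err = "\<lambda>w. (X (fst w) - ?g (channel_output X snr w))\<^sup>2"
  let ?c = "16 / (sqrt snr ^ 4 * A\<^sup>2)"
  have "mmse M X snr \<le> (\<integral>w. ?err w \<partial>?C)"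
  proof (rule mmse_le_estimator_error[OF M X, of ?g A])
    show "\<bar>X \<omega>\<bar> \<le> A" for \<omega>
      using val[of \<omega>] A by auto
  qed (use A in auto)
  also have "\<dots> \<le> (\<integral>w. ?c * snd w ^ 4 \<partial>?C)"
  proof (rule Bochner_Integration.integral_mono')
    show "integrable ?C (\<lambda>w. ?c * snd w ^ 4)"
      using fourth_moment_channel_noise(1)[OF M] by simp
    show "?err w \<le> ?c * snd w ^ 4" for w
      using threshold_square_error_le[of "sqrt snr" A "X (fst w)" "snd w"] s A val[of "fst w"]
      by (simp add: channel_output_def case_prod_beta)
  qed simp
  also have "\<dots> = ?c * 3"
    using fourth_moment_channel_noise[OF M] by simp
  also have "\<dots> = 48 / (snr\<^sup>2 * A\<^sup>2)"
  proof -
    have "sqrt snr ^ 4 = ((sqrt snr)\<^sup>2)\<^sup>2"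
      by (simp flip: power_mult)
    also have "\<dots> = snr\<^sup>2"
      using s by simp
    finally show ?thesis
      by simp
  qed
  finally show ?thesis .
qed

theorem proposition12:
  fixes snr0 \<beta> :: real
  assumes "snr0 > 0" and "\<beta> > 0"
  shows "\<exists>(M :: real measure) (X :: real \<Rightarrow> real).
           prob_space M \<and> X \<in> borel_measurable M \<and>
           integrable M (\<lambda>\<omega>. (X \<omega>)\<^sup>2) \<and> (\<integral>\<omega>. (X \<omega>)\<^sup>2 \<partial>M) = 1 \<and>
           mmse M X snr0 \<le> \<beta> / (1 + \<beta> * snr0)"
proof -
  define a where "a = max 1 (48 * (1 + \<beta> * snr0) / (snr0\<^sup>2 * \<beta>))"
  define M :: "real measure" where
    "M = measure_pmf (map_pmf of_bool (bernoulli_pmf (1 / a)))"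
  define X :: "real \<Rightarrow> real" where "X = (\<lambda>\<omega>. if \<omega> = 1 then sqrt a else 0)"
  have a: "1 \<le> a" "48 * (1 + \<beta> * snr0) / (snr0\<^sup>2 * \<beta>) \<le> a"
    by (auto simp: a_def)
  have "0 < 1 + \<beta> * snr0"
    using assms by (simp add: add_pos_pos)
  have M: "prob_space M"
    unfolding M_def by (rule prob_space_measure_pmf)
  interpret prob_space M by (rule M)
  have X [measurable]: "X \<in> borel_measurable M"
    by (simp add: M_def)
  have "integrable M (\<lambda>\<omega>. (X \<omega>)\<^sup>2)"
    by (rule integrable_const_bound[where B = a]) (use a in \<open>auto simp: X_def M_def\<close>)
  moreover have "(\<integral>\<omega>. (X \<omega>)\<^sup>2 \<partial>M) = 1"
    using a by (simp add: M_def X_def)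
  moreover have "mmse M X snr0 \<le> 48 / (snr0\<^sup>2 * (sqrt a)\<^sup>2)"
    by (rule mmse_two_point_le[OF M X]) (use assms a in \<open>auto simp: X_def\<close>)
  moreover have "48 / (snr0\<^sup>2 * (sqrt a)\<^sup>2) \<le> \<beta> / (1 + \<beta> * snr0)"
    using a assms \<open>0 < 1 + \<beta> * snr0\<close> by (simp add: field_simps)
  ultimately show ?thesis
    using M X by (intro exI[of _ M] exI[of _ X]) auto
qed

end
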